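(* For every integer $k\geq 2$, every finite digraph $D$ is $\frac{1}{k}$-majority $2k$-choosable: for any assignment to each vertex $v$ of a list $L(v)$ of $2k$ colours, there is a colouring $c$ with $c(v)\in L(v)$ for every vertex $v$, such that for every vertex $v$ the number of out-neighbours $w$ of $v$ with $c(w)=c(v)$ is at most $d^{+}(v)/k$, where $d^{+}(v)$ is the out-degree of $v$.
   Context: A $\frac{1}{k}$-majority colouring of a digraph is a colouring of its vertices such that each vertex receives the same colour as at most a $1/k$ proportion of its out-neighbours. A digraph is $\frac{1}{k}$-majority $m$-choosable if for any assignment of lists of $m$ colours to the vertices there is a $\frac{1}{k}$-majority colouring in which each vertex gets a colour from its list. *)

theory Defs
  imports Complex_Main "Graph_Theory.Digraph"
begin

definition out_neighbours :: "('a, 'b) pre_digraph \<Rightarrow> 'a \<Rightarrow> 'a set" where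
  "out_neighbours G v = {w. v \<rightarrow>\<^bsub>G\<^esub> w}"

definition majority_colouring :: "nat \<Rightarrow> ('a, 'b) pre_digraph \<Rightarrow> ('a \<Rightarrow> 'c) \<Rightarrow> bool" where
  "majority_colouring k G c \<longleftrightarrow>
     (\<forall>v \<in> verts G.
        real (card {w \<in> out_neighbours G v. c w = c v}) \<le> real (out_degree G v) / real k)"

text \<open>
  A definition cannot quantify over types, so the type of colours is passed as an argument.
  Colourings and list assignments are total functions, but only their values on the vertices
  matter. Lists are sets of exactly \<open>m\<close> distinct colours; \<open>finite\<close> is only relevant for \<open>m = 0\<close>.
\<close>
definition majority_choosable ::
    "'c itself \<Rightarrow> nat \<Rightarrow> nat \<Rightarrow> ('a, 'b) pre_digraph \<Rightarrow> bool" where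
  "majority_choosable _ k m G \<longleftrightarrow>
     (\<forall>L :: 'a \<Rightarrow> 'c set.
        (\<forall>v \<in> verts G. finite (L v) \<and> card (L v) = m) \<longrightarrow>
        (\<exists>c. (\<forall>v \<in> verts G. c v \<in> L v) \<and> majority_colouring k G c))"

end

theory Submission
  imports Defs "HOL-Library.FuncSet"
begin

text \<open>
  Give each arc leaving \<open>v\<close> the weight \<open>1 / d\<^sup>+(v)\<close>, so that the weights form a substochastic
  matrix \<open>m\<close>. Such a matrix has a nonzero vector \<open>p \<ge> 0\<close> with \<open>p m \<le> p\<close>. On its support \<open>C\<close>, choose
  a list colouring that minimises the total weight \<open>p(u) m(u, w)\<close> of the monochromatic arcs leaving \<open>C\<close>.
  For \<open>v \<in> C\<close> the weights of all arcs at \<open>v\<close>, in both directions, add up to at most \<open>2 p(v)\<close>, so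
  some colour of the list accounts for at most \<open>p(v) / k\<close>, and by minimality the colour of \<open>v\<close> does too.
  No arc of positive weight leads from \<open>C\<close> to a vertex that is still uncoloured, so the remaining
  vertices can be coloured afterwards without spoiling \<open>C\<close>.
\<close>

text \<open>
  The induction eliminates a state \<open>u\<close> of the Markov chain: the reduced matrix also counts
  the paths through \<open>u\<close>, with \<open>1 / (1 - m u u)\<close> summing the repeated visits to \<open>u\<close>.
\<close>
lemma substochastic_subinvariant_vector:
  fixes m :: "'a \<Rightarrow> 'a \<Rightarrow> real"
  assumes "finite U" "U \<noteq> {}"
    and "\<And>v w. v \<in> U \<Longrightarrow> w \<in> U \<Longrightarrow> 0 \<le> m v w"
    and "\<And>v. v \<in> U \<Longrightarrow> (\<Sum>w\<in>U. m v w) \<le> 1"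
  shows "\<exists>p. (\<forall>v\<in>U. 0 \<le> p v) \<and> (\<exists>v\<in>U. 0 < p v) \<and> (\<forall>w\<in>U. (\<Sum>v\<in>U. p v * m v w) \<le> p w)"
  using assms
proof (induction U arbitrary: m rule: finite_ne_induct)
  case (singleton u)
  then show ?case by (intro exI[of _ "\<lambda>_. 1"]) auto
next
  case (insert u U)
  have nn: "0 \<le> m v w" if "v \<in> insert u U" "w \<in> insert u U" for v w
    using insert.prems(1) that by blast
  have row: "m v u + (\<Sum>w\<in>U. m v w) \<le> 1" if "v \<in> insert u U" for v
    using insert.prems(2)[OF that] insert.hyps by simp
  have rest_nn: "0 \<le> (\<Sum>w\<in>U. m u w)" by (intro sum_nonneg) (simp add: nn)
  show ?case
  proof (cases "m u u = 1")
    case True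
    \<comment> \<open>State \<open>u\<close> is absorbing: no weight leaves it, so the unit mass at
      \<open>u\<close> is invariant.\<close>
    then have "(\<Sum>w\<in>U. m u w) = 0" using row[of u] rest_nn by simp
    then have "\<forall>w\<in>U. m u w = 0"
      using insert.hyps(1) by (subst (asm) sum_nonneg_eq_0_iff) (auto simp: nn)
    moreover have "(\<Sum>v\<in>U. (if v = u then 1 else 0) * m v w) = 0" for w
      using insert.hyps by (intro sum.neutral) auto
    ultimately show ?thesis
      using True insert.hyps by (intro exI[of _ "\<lambda>v. if v = u then 1 else 0"]) auto
  next
    case False
    define d where "d = 1 - m u u"
    have d: "0 < d" using False row[of u] rest_nn by (simp add: d_def)
    define m' where "m' v w = m v w + m v u * m u w / d" for v w
    have "0 \<le> m' v w" if "v \<in> U" "w \<in> U" for v w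
      using that d by (simp add: m'_def nn)
    moreover have "(\<Sum>w\<in>U. m' v w) \<le> 1" if "v \<in> U" for v
    proof -
      have "(\<Sum>w\<in>U. m' v w) = (\<Sum>w\<in>U. m v w) + m v u * ((\<Sum>w\<in>U. m u w) / d)"
        by (simp add: m'_def sum.distrib sum_distrib_left sum_divide_distrib)
      \<comment> \<open>Row \<open>u\<close> leaves at most \<open>d\<close> for \<open>U\<close>,
        so rerouting the weight \<open>m v u\<close> through \<open>u\<close> does not increase
        it.\<close>
      also have "\<dots> \<le> (\<Sum>w\<in>U. m v w) + m v u * 1"
        using row[of u] d that by (intro add_left_mono mult_left_mono) (auto simp: d_def nn)
      also have "\<dots> \<le> 1" using row[of v] that by simp
      finally show ?thesis .
    qed
    ultimately obtain p where p: "\<forall>v\<in>U. 0 \<le> p v" "\<exists>v\<in>U. 0 < p v"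
        "\<forall>w\<in>U. (\<Sum>v\<in>U. p v * m' v w) \<le> p w"
      using insert.IH[of m'] by blast
    \<comment> \<open>The solution of \<open>s = s * m u u + (\<Sum>v\<in>U. p v * m v u)\<close>:
      the condition at \<open>u\<close> then holds with equality, and substituting \<open>s\<close>
      in the other columns turns \<open>m\<close> into \<open>m'\<close>.\<close>
    define s where "s = (\<Sum>v\<in>U. p v * m v u) / d"
    have s: "0 \<le> s" unfolding s_def using p(1) d by (intro divide_nonneg_pos sum_nonneg) (auto simp: nn)
    define q where "q = p(u := s)"
    have q_sum: "(\<Sum>v\<in>insert u U. q v * m v w) = s * m u w + (\<Sum>v\<in>U. p v * m v w)" for w
    proof -
      have "(\<Sum>v\<in>U. q v * m v w) = (\<Sum>v\<in>U. p v * m v w)"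
        using insert.hyps by (intro sum.cong) (auto simp: q_def)
      then show ?thesis using insert.hyps by (simp add: q_def)
    qed
    have "(\<Sum>v\<in>insert u U. q v * m v w) \<le> q w" if "w \<in> insert u U" for w
    proof (cases "w = u")
      case True
      have "(\<Sum>v\<in>U. p v * m v u) = s * d" using d by (simp add: s_def)
      then show ?thesis unfolding q_sum True by (simp add: q_def d_def algebra_simps)
    next
      case False
      have "s * m u w + (\<Sum>v\<in>U. p v * m v w) = (\<Sum>v\<in>U. p v * m' v w)"
        by (simp add: s_def m'_def sum.distrib sum_distrib_left sum_distrib_right
              sum_divide_distrib algebra_simps)
      then show ?thesis unfolding q_sum using False that p(3) by (simp add: q_def)
    qed
    moreover have "\<forall>v\<in>insert u U. 0 \<le> q v" "\<exists>v\<in>insert u U. 0 < q v"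
      using p s insert.hyps by (auto simp: q_def)
    ultimately show ?thesis by blast
  qed
qed

lemma sum_of_bool_eq_le:
  assumes "finite L"
  shows "(\<Sum>a\<in>L. of_bool (x = a)) \<le> (1::real)"
  using assms by (simp add: of_bool_def)

text \<open>Outside \<open>C\<close> the colouring \<open>c0\<close> is frozen. Recolouring one
  \<open>v\<close> in \<open>C\<close> affects only arcs leaving \<open>v\<close>, of total weight
  at most \<open>p v\<close> by \<open>row\<close>, and arcs from \<open>C\<close> into
  \<open>v\<close>, at most \<open>p v\<close> by \<open>sub\<close>. A minimiser therefore pays at
  most the average over the \<open>2 * k\<close> colours.\<close>

lemma list_colouring_of_subinvariant_support:
  fixes m :: "'a \<Rightarrow> 'a \<Rightarrow> real" and L :: "'a \<Rightarrow> 'c set"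
  assumes V: "finite V" "C \<subseteq> V"
    and nn: "\<And>v w. v \<in> V \<Longrightarrow> w \<in> V \<Longrightarrow> 0 \<le> m v w"
    and row: "\<And>v. v \<in> C \<Longrightarrow> (\<Sum>w\<in>V. m v w) \<le> 1"
    and diag: "\<And>v. v \<in> C \<Longrightarrow> m v v = 0"
    and pos: "\<And>v. v \<in> C \<Longrightarrow> 0 < p v"
    and sub: "\<And>w. w \<in> C \<Longrightarrow> (\<Sum>v\<in>C. p v * m v w) \<le> p w"
    and k: "0 < k"
    and L: "\<And>v. v \<in> C \<Longrightarrow> finite (L v) \<and> card (L v) = 2 * k"
  shows "\<exists>c. (\<forall>v\<in>C. c v \<in> L v) \<and> (\<forall>v. v \<notin> C \<longrightarrow> c v = c0 v) \<and>
    (\<forall>v\<in>C. (\<Sum>w\<in>V. m v w * of_bool (c w = c v)) \<le> 1 / real k)"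
proof -
  \<comment> \<open>\<open>PiE C L\<close> is finite but undefined off \<open>C\<close>; the image
    puts \<open>c0\<close> there, so a minimiser of \<open>\<Phi>\<close> exists.\<close>
  define S where "S = (\<lambda>f v. if v \<in> C then f v else c0 v) ` (PiE C L)"
  define \<Phi> where "\<Phi> c = (\<Sum>u\<in>C. \<Sum>w\<in>V. p u * m u w * of_bool (c w = c u))" for c :: "'a \<Rightarrow> 'c"
  have finC: "finite C" using V finite_subset by blast
  have S_iff: "c \<in> S \<longleftrightarrow> (\<forall>v\<in>C. c v \<in> L v) \<and> (\<forall>v. v \<notin> C \<longrightarrow> c v = c0 v)" for c
  proof
    assume "(\<forall>v\<in>C. c v \<in> L v) \<and> (\<forall>v. v \<notin> C \<longrightarrow> c v = c0 v)"
    then show "c \<in> S"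
      unfolding S_def by (intro image_eqI[of _ _ "restrict c C"]) (auto simp: fun_eq_iff)
  qed (auto simp: S_def)
  have "finite S" unfolding S_def using finC L by (intro finite_imageI finite_PiE) auto
  moreover have "\<forall>v\<in>C. L v \<noteq> {}" using L k by fastforce
  then have "S \<noteq> {}" by (auto simp: S_def PiE_eq_empty_iff)
  ultimately obtain c where c: "c \<in> S" and cmin: "\<And>c'. c' \<in> S \<Longrightarrow> \<Phi> c \<le> \<Phi> c'"
    using ex_min_if_finite[of "\<Phi> ` S"] by (force simp: not_less)
  have "(\<Sum>w\<in>V. m v w * of_bool (c w = c v)) \<le> 1 / real k" if v: "v \<in> C" for v
  proof -
    have vV: "v \<in> V" using v V by blast
    \<comment> \<open>If \<open>v\<close> gets colour \<open>a\<close>, then \<open>A a\<close> is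
      the cost of arcs leaving \<open>v\<close>, \<open>B a\<close> that of arcs entering
      \<open>v\<close> from \<open>C\<close>, and \<open>R\<close> the cost of all other arcs,
      independent of \<open>a\<close>.\<close>
    define A where "A a = (\<Sum>w\<in>V. p v * m v w * of_bool (c w = a))" for a
    define B where "B a = (\<Sum>u\<in>C - {v}. p u * m u v * of_bool (c u = a))" for a
    define R where "R = (\<Sum>u\<in>C - {v}. \<Sum>w\<in>V - {v}. p u * m u w * of_bool (c w = c u))"
    have split: "\<Phi> (c(v := a)) = A a + B a + R" for a
    proof -
      have "(\<Sum>w\<in>V. p v * m v w * of_bool ((c(v := a)) w = (c(v := a)) v)) = A a"
        \<comment> \<open>\<open>A a\<close> reads the old colour of \<open>v\<close> at
          \<open>w = v\<close>; the zero diagonal makes this harmless.\<close>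
        unfolding A_def by (intro sum.cong) (auto simp: diag v)
      moreover have "(\<Sum>w\<in>V. p u * m u w * of_bool ((c(v := a)) w = (c(v := a)) u)) =
          p u * m u v * of_bool (c u = a) + (\<Sum>w\<in>V - {v}. p u * m u w * of_bool (c w = c u))"
        if "u \<in> C - {v}" for u
        using that by (subst sum.remove[OF V(1) vV]) (auto intro!: sum.cong)
      ultimately show ?thesis
        unfolding \<Phi>_def B_def R_def
        by (subst sum.remove[OF finC v]) (simp add: sum.distrib)
    qed
    have le: "A (c v) + B (c v) \<le> A a + B a" if "a \<in> L v" for a
    proof -
      have "c(v := a) \<in> S" using c that v by (auto simp: S_iff)
      \<comment> \<open>Writing \<open>c\<close> as a trivial update lets \<open>split\<close> apply
        to both sides, and \<open>R\<close> cancels.\<close>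
      then have "\<Phi> (c(v := c v)) \<le> \<Phi> (c(v := a))" using cmin by simp
      then show ?thesis unfolding split by simp
    qed
    have sumA: "(\<Sum>a\<in>L v. A a) \<le> p v"
    proof -
      have "(\<Sum>a\<in>L v. A a) = (\<Sum>w\<in>V. p v * m v w * (\<Sum>a\<in>L v. of_bool (c w = a)))"
        unfolding A_def sum_distrib_left by (rule sum.swap)
      also have "\<dots> \<le> (\<Sum>w\<in>V. p v * m v w * 1)"
        using L[OF v] pos[OF v] vV by (intro sum_mono mult_left_mono sum_of_bool_eq_le) (auto simp: nn)
      also have "\<dots> = p v * (\<Sum>w\<in>V. m v w)" by (simp add: sum_distrib_left)
      also have "\<dots> \<le> p v * 1" using row[OF v] pos[OF v] by (intro mult_left_mono) auto
      finally show ?thesis by simp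
    qed
    have pm_nn: "0 \<le> p u * m u v" if "u \<in> C" for u
      using pos[OF that] nn[of u v] that V vV by (auto intro!: mult_nonneg_nonneg)
    have sumB: "(\<Sum>a\<in>L v. B a) \<le> p v"
    proof -
      have "(\<Sum>a\<in>L v. B a) = (\<Sum>u\<in>C - {v}. p u * m u v * (\<Sum>a\<in>L v. of_bool (c u = a)))"
        unfolding B_def sum_distrib_left by (rule sum.swap)
      also have "\<dots> \<le> (\<Sum>u\<in>C - {v}. p u * m u v * 1)"
        using L[OF v] pm_nn by (intro sum_mono mult_left_mono sum_of_bool_eq_le) auto
      also have "\<dots> \<le> (\<Sum>u\<in>C. p u * m u v)"
        using finC pm_nn by (simp, intro sum_mono2) auto
      finally show ?thesis using sub[OF v] by simp
    qed
    have "real (2 * k) * (A (c v) + B (c v)) \<le> (\<Sum>a\<in>L v. A a + B a)"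
      using sum_bounded_below[of "L v" "A (c v) + B (c v)" "\<lambda>a. A a + B a"] le L[OF v] by simp
    also have "\<dots> \<le> 2 * p v" using sumA sumB by (simp add: sum.distrib)
    finally have "real k * (A (c v) + B (c v)) \<le> p v" by simp
    moreover have "0 \<le> B (c v)" unfolding B_def using pm_nn by (intro sum_nonneg) auto
    then have "real k * A (c v) \<le> real k * (A (c v) + B (c v))" by (intro mult_left_mono) auto
    moreover have "A (c v) = p v * (\<Sum>w\<in>V. m v w * of_bool (c w = c v))"
      by (simp add: A_def sum_distrib_left mult.assoc)
    ultimately have "p v * (real k * (\<Sum>w\<in>V. m v w * of_bool (c w = c v))) \<le> p v * 1"
      by (simp add: mult.left_commute)
    then have "real k * (\<Sum>w\<in>V. m v w * of_bool (c w = c v)) \<le> 1"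
      using pos[OF v] by (simp only: mult_le_cancel_left_pos)
    then show ?thesis using k by (simp add: field_simps)
  qed
  then show ?thesis using c S_iff by blast
qed

text \<open>Induction on the set \<open>U\<close> still to be coloured, with the colours elsewhere
  frozen as \<open>c0\<close>. The support \<open>C\<close> of a subinvariant vector on
  \<open>U\<close> is coloured first; then \<open>U - C\<close> is coloured with \<open>C\<close>
  frozen too, which is why \<open>c0\<close> must be arbitrary.\<close>

lemma weighted_majority_list_colouring:
  fixes m :: "'a \<Rightarrow> 'a \<Rightarrow> real" and L :: "'a \<Rightarrow> 'c set"
  assumes V: "finite V" "U \<subseteq> V"
    and nn: "\<And>v w. v \<in> V \<Longrightarrow> w \<in> V \<Longrightarrow> 0 \<le> m v w"
    and row: "\<And>v. v \<in> V \<Longrightarrow> (\<Sum>w\<in>V. m v w) \<le> 1"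
    and diag: "\<And>v. v \<in> V \<Longrightarrow> m v v = 0"
    and k: "0 < k"
    and L: "\<And>v. v \<in> V \<Longrightarrow> finite (L v) \<and> card (L v) = 2 * k"
  shows "\<exists>c. (\<forall>v\<in>U. c v \<in> L v) \<and> (\<forall>v. v \<notin> U \<longrightarrow> c v = c0 v) \<and>
    (\<forall>v\<in>U. (\<Sum>w\<in>V. m v w * of_bool (c w = c v)) \<le> 1 / real k)"
proof -
  have "finite U" using V finite_subset by blast
  then show ?thesis using V(2)
  proof (induction U arbitrary: c0 rule: finite_psubset_induct)
    case (psubset U)
    show ?case
    proof (cases "U = {}")
      case False
      have "(\<Sum>w\<in>U. m v w) \<le> 1" if "v \<in> U" for v
      proof -
        have "(\<Sum>w\<in>U. m v w) \<le> (\<Sum>w\<in>V. m v w)"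
          using V psubset.prems that by (intro sum_mono2) (auto simp: nn)
        then show ?thesis using row[of v] that psubset.prems by auto
      qed
      then obtain p where p: "\<forall>v\<in>U. 0 \<le> p v" "\<exists>v\<in>U. 0 < p v"
          "\<forall>w\<in>U. (\<Sum>v\<in>U. p v * m v w) \<le> p w"
        using substochastic_subinvariant_vector[OF psubset.hyps False, of m] nn psubset.prems
        by blast
      define C where "C = {v \<in> U. 0 < p v}"
      have C: "C \<subseteq> U" "C \<noteq> {}" using p(2) by (auto simp: C_def)
      have sub: "(\<Sum>v\<in>C. p v * m v w) \<le> p w" if "w \<in> C" for w
      proof -
        have "(\<Sum>v\<in>C. p v * m v w) \<le> (\<Sum>v\<in>U. p v * m v w)"
          using C(1) psubset p(1) that by (intro sum_mono2) (auto intro!: mult_nonneg_nonneg nn)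
        then show ?thesis using p(3) that C(1) by fastforce
      qed
      \<comment> \<open>Since \<open>p w = 0\<close>, subinvariance at \<open>w\<close> forces every
        nonnegative term of its column sum to vanish.\<close>
      have closed: "m v w = 0" if "v \<in> C" "w \<in> U - C" for v w
      proof -
        have "p v * m v w \<le> (\<Sum>v\<in>U. p v * m v w)"
          using C(1) that psubset p(1)
          by (intro member_le_sum[of v U "\<lambda>v. p v * m v w"]) (auto intro!: mult_nonneg_nonneg nn)
        also have "\<dots> \<le> 0" using p that by (force simp: C_def)
        finally have "m v w \<le> 0" using that by (simp add: C_def mult_le_0_iff)
        then show ?thesis using nn[of v w] that C(1) psubset.prems by auto
      qed
      have CV: "v \<in> V" "0 < p v" if "v \<in> C" for v
        using that psubset.prems by (auto simp: C_def)
      have "C \<subseteq> V" using CV(1) by blast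
      \<comment> \<open>On \<open>U - C\<close> the values of \<open>c1\<close> are only
        provisional; by \<open>closed\<close>, changing them does not affect the sums at
        \<open>C\<close>.\<close>
      then obtain c1 where c1: "\<forall>v\<in>C. c1 v \<in> L v" "\<forall>v. v \<notin> C \<longrightarrow> c1 v = c0 v"
          "\<forall>v\<in>C. (\<Sum>w\<in>V. m v w * of_bool (c1 w = c1 v)) \<le> 1 / real k"
        using list_colouring_of_subinvariant_support[of V C m p k L c0, OF V(1) _ nn
          row[OF CV(1)] diag[OF CV(1)] CV(2) sub k L[OF CV(1)]] by blast
      obtain c where c: "\<forall>v\<in>U - C. c v \<in> L v" "\<forall>v. v \<notin> U - C \<longrightarrow> c v = c1 v"
          "\<forall>v\<in>U - C. (\<Sum>w\<in>V. m v w * of_bool (c w = c v)) \<le> 1 / real k"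
        using psubset.IH[of "U - C" c1] C psubset.prems by blast
      have "(\<Sum>w\<in>V. m v w * of_bool (c w = c v)) \<le> 1 / real k" if "v \<in> C" for v
      proof -
        have "m v w * of_bool (c w = c v) = m v w * of_bool (c1 w = c1 v)" for w
          using closed[OF that] c(2) that by (cases "w \<in> U - C") auto
        then show ?thesis using c1(3) that by (simp only:)
      qed
      moreover have "c v \<in> L v" if "v \<in> C" for v using c(2) c1(1) that by simp
      moreover have "c v = c0 v" if "v \<notin> U" for v using c(2) c1(2) that C(1) by auto
      ultimately show ?thesis using c(1,3) by blast
    qed auto
  qed
qed

theorem theorem4:
  fixes G :: "('a, 'b) pre_digraph" and k :: nat
  assumes "digraph G" and "k \<ge> 2"
  shows "majority_choosable TYPE('c) k (2 * k) G"
proof -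
  interpret digraph G by fact
  let ?N = "out_neighbours G" and ?d = "out_degree G"
  \<comment> \<open>For a sink the division by zero makes the whole row zero.\<close>
  define m where "m v w = of_bool (w \<in> ?N v) / real (?d v)" for v w
  have N_sub: "?N v \<subseteq> verts G" for v
    by (auto simp: out_neighbours_def)
  have finN: "finite (?N v)" for v
    using N_sub finite_verts by (rule finite_subset)
  \<comment> \<open>Neighbours are vertices while the out-degree counts arcs; taking heads maps the
    arcs onto the neighbours.\<close>
  have card_N: "card (?N v) \<le> ?d v" for v
  proof -
    have "?N v \<subseteq> head G ` out_arcs G v"
      by (auto simp: out_neighbours_def out_arcs_def arcs_ends_def arc_to_ends_def)
    then show ?thesis
      unfolding out_degree_def by (intro surj_card_le) auto
  qed
  \<comment> \<open>Used with \<open>P\<close> constantly true for the row sums, and with equality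
    of colours for the majority condition.\<close>
  have m_sum: "(\<Sum>w\<in>verts G. m v w * of_bool (P w)) = real (card {w \<in> ?N v. P w}) / real (?d v)" for v P
  proof -
    have "(\<Sum>w\<in>verts G. m v w * of_bool (P w)) =
        (\<Sum>w\<in>verts G. of_bool (w \<in> {w \<in> ?N v. P w})) / real (?d v)"
      unfolding sum_divide_distrib by (intro sum.cong) (auto simp: m_def)
    also have "verts G \<inter> {w \<in> ?N v. P w} = {w \<in> ?N v. P w}" using N_sub by auto
    then have "(\<Sum>w\<in>verts G. of_bool (w \<in> {w \<in> ?N v. P w})) = real (card {w \<in> ?N v. P w})"
      by (subst sum_of_bool_eq) auto
    finally show ?thesis .
  qed
  have row: "(\<Sum>w\<in>verts G. m v w) \<le> 1" for v
    using m_sum[of v "\<lambda>_. True"] card_N[of v] by (cases "?d v = 0") auto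
  have m_nn: "0 \<le> m v w" for v w by (simp add: m_def)
  have k: "0 < k" using assms(2) by simp
  have diag: "m v v = 0" for v
    using adj_not_same by (auto simp: m_def out_neighbours_def)
  show ?thesis
    unfolding majority_choosable_def
  proof (intro allI impI)
    fix L :: "'a \<Rightarrow> 'c set"
    assume "\<forall>v\<in>verts G. finite (L v) \<and> card (L v) = 2 * k"
    then have L: "finite (L v) \<and> card (L v) = 2 * k" if "v \<in> verts G" for v
      using that by blast
    obtain c where c: "\<forall>v\<in>verts G. c v \<in> L v"
        "\<forall>v\<in>verts G. (\<Sum>w\<in>verts G. m v w * of_bool (c w = c v)) \<le> 1 / real k"
      using weighted_majority_list_colouring[of "verts G" "verts G" m k L, OF finite_verts
          subset_refl m_nn row diag k L] by blast
    have "real (card {w \<in> ?N v. c w = c v}) \<le> real (?d v) / real k" if "v \<in> verts G" for v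
    proof (cases "?d v = 0")
      \<comment> \<open>A sink has no out-neighbours by \<open>card_N\<close>, so both sides are
        zero.\<close>
      case True
      then show ?thesis using card_N[of v] finN by simp
    next
      case False
      then show ?thesis
        using bspec[OF c(2) that] by (simp add: m_sum pos_divide_le_eq)
    qed
    then show "\<exists>c. (\<forall>v\<in>verts G. c v \<in> L v) \<and> majority_colouring k G c"
      using c(1) unfolding majority_colouring_def by blast
  qed
qed

end
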